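(* $\bar n(t,2)<t+6$ for every integer $t\ge 0$.
   Context: An oriented matroid $M$ on a finite set $E$ is acyclic if it has no positive circuit. A reorientation of $M$ on $A\subseteq E$ is obtained by changing the signs of the elements of $A$ in all signed circuits of $M$; it is acyclic if the resulting oriented matroid is acyclic. An element $e$ of an acyclic oriented matroid is interior if there is a signed circuit $C=(C^+,C^-)$ with $C^-=\{e\}$. For integers $t\ge 0$, $d\ge 1$, $\bar n(t,d)$ is the largest integer $m$ such that every uniform oriented matroid of rank $d+1$ with $m$ elements has an acyclic reorientation with at most $t$ interior elements. *)

theory Defs
  imports Main "HOL-Library.Extended_Nat"
begin

text \<open>A signed set \<open>X = (X\<^sup>+, X\<^sup>-)\<close> is the pair of its positive and its negative part.\<close>

type_synonym 'a signed_set = "'a set \<times> 'a set"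

definition support :: "'a signed_set \<Rightarrow> 'a set" where
  "support X = fst X \<union> snd X"

definition opposite :: "'a signed_set \<Rightarrow> 'a signed_set" where
  "opposite X = (snd X, fst X)"

locale oriented_matroid =
  fixes E :: "'a set" and \<C> :: "'a signed_set set"
  assumes finite_ground: "finite E"
    and circuit_subset: "X \<in> \<C> \<Longrightarrow> support X \<subseteq> E"
    and circuit_disjoint: "X \<in> \<C> \<Longrightarrow> fst X \<inter> snd X = {}"
    and empty_not_circuit: "({}, {}) \<notin> \<C>"
    and symmetry: "X \<in> \<C> \<Longrightarrow> opposite X \<in> \<C>"
    and incomparability:
      "X \<in> \<C> \<Longrightarrow> Y \<in> \<C> \<Longrightarrow> support X \<subseteq> support Y \<Longrightarrow> X = Y \<or> X = opposite Y"
    and elimination: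
      "X \<in> \<C> \<Longrightarrow> Y \<in> \<C> \<Longrightarrow> X \<noteq> opposite Y \<Longrightarrow> e \<in> fst X \<inter> snd Y \<Longrightarrow>
        \<exists>Z\<in>\<C>. fst Z \<subseteq> (fst X \<union> fst Y) - {e} \<and> snd Z \<subseteq> (snd X \<union> snd Y) - {e}"

definition independent_in :: "'a set \<Rightarrow> 'a signed_set set \<Rightarrow> 'a set \<Rightarrow> bool" where
  "independent_in E \<C> I \<longleftrightarrow> I \<subseteq> E \<and> \<not> (\<exists>X\<in>\<C>. support X \<subseteq> I)"

definition om_rank :: "'a set \<Rightarrow> 'a signed_set set \<Rightarrow> nat" where
  "om_rank E \<C> = Max (card ` {I. independent_in E \<C> I})"

definition uniform_om :: "'a set \<Rightarrow> 'a signed_set set \<Rightarrow> bool" where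
  "uniform_om E \<C> \<longleftrightarrow> (\<forall>B. B \<subseteq> E \<and> card B = om_rank E \<C> \<longrightarrow> independent_in E \<C> B)"

definition acyclic_om :: "'a signed_set set \<Rightarrow> bool" where
  "acyclic_om \<C> \<longleftrightarrow> \<not> (\<exists>X\<in>\<C>. snd X = {})"

definition flip_signs :: "'a set \<Rightarrow> 'a signed_set \<Rightarrow> 'a signed_set" where
  "flip_signs A X = ((fst X - A) \<union> (snd X \<inter> A), (snd X - A) \<union> (fst X \<inter> A))"

definition reorientation :: "'a set \<Rightarrow> 'a signed_set set \<Rightarrow> 'a signed_set set" where
  "reorientation A \<C> = flip_signs A ` \<C>"

definition interior_elements :: "'a set \<Rightarrow> 'a signed_set set \<Rightarrow> 'a set" where
  "interior_elements E \<C> = {e \<in> E. \<exists>X\<in>\<C>. snd X = {e}}"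

text \<open>The ground sets range over the finite sets of natural numbers, which is no restriction:
  every finite set is in bijection with one of these.\<close>

definition reorientable :: "nat \<Rightarrow> nat \<Rightarrow> nat \<Rightarrow> bool" where
  "reorientable t d m \<longleftrightarrow>
    (\<forall>(E :: nat set) \<C>.
      oriented_matroid E \<C> \<and> uniform_om E \<C> \<and> om_rank E \<C> = d + 1 \<and> card E = m \<longrightarrow>
      (\<exists>A\<subseteq>E. acyclic_om (reorientation A \<C>) \<and>
        card (interior_elements E (reorientation A \<C>)) \<le> t))"

text \<open>The largest \<open>m\<close> with \<open>reorientable t d m\<close>. The supremum is taken in \<^typ>\<open>enat\<close>, so that it
  is \<open>\<infinity>\<close> if there is no largest such \<open>m\<close>; an upper bound on \<open>n_bar t d\<close> thus includes the claim
  that the largest \<open>m\<close> exists.\<close>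

definition n_bar :: "nat \<Rightarrow> nat \<Rightarrow> enat" where
  "n_bar t d = Sup {enat m | m. reorientable t d m}"

lemma reorientable_0: "reorientable t d 0"
proof -
  have False if om: "oriented_matroid E \<C>" and r: "om_rank E \<C> = d + 1" and c: "card E = 0"
    for E :: "nat set" and \<C>
  proof -
    have "E = {}"
      using c oriented_matroid.finite_ground[OF om] by simp
    moreover have "\<not> (\<exists>X\<in>\<C>. support X \<subseteq> {})"
      using oriented_matroid.empty_not_circuit[OF om] by (auto simp: support_def)
    ultimately have "{I. independent_in E \<C> I} = {{}}"
      by (auto simp: independent_in_def)
    then show False
      using r by (simp add: om_rank_def)
  qed
  then show ?thesis
    unfolding reorientable_def by blast
qed

lemma n_bar_eq_enat_iff:
  "n_bar t d = enat m \<longleftrightarrow> reorientable t d m \<and> (\<forall>k. reorientable t d k \<longrightarrow> k \<le> m)"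
proof
  let ?S = "{enat k | k. reorientable t d k}"
  assume eq: "n_bar t d = enat m"
  have le: "k \<le> m" if "reorientable t d k" for k
  proof -
    have "enat k \<le> Sup ?S" using that by (intro Sup_upper) auto
    then show ?thesis using eq by (simp add: n_bar_def)
  qed
  have "?S \<subseteq> enat ` {..m}" using le by auto
  then have fin: "finite ?S" by (rule finite_subset) simp
  have ne: "?S \<noteq> {}" using reorientable_0 by blast
  have "Sup ?S = Max ?S"
    unfolding Sup_enat_def using fin ne by (simp only: if_True if_False)
  then have "Sup ?S \<in> ?S" using Max_in[OF fin ne] by (simp only:)
  then show "reorientable t d m \<and> (\<forall>k. reorientable t d k \<longrightarrow> k \<le> m)"
    using eq le by (auto simp: n_bar_def)
next
  assume "reorientable t d m \<and> (\<forall>k. reorientable t d k \<longrightarrow> k \<le> m)"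
  then show "n_bar t d = enat m"
    unfolding n_bar_def by (intro Sup_eqI) auto
qed

end

theory Submission
  imports Defs Complex_Main
begin

text \<open>The bound says that for every \<open>m \<ge> t + 6\<close> there is a uniform oriented matroid of rank 3 on
  \<open>m\<close> elements all of whose acyclic reorientations have more than \<open>t\<close> interior elements. One
  family serves for all \<open>t\<close>: it has at most five non-interior elements in every acyclic
  reorientation, hence at least \<open>m - 5 \<ge> t + 1\<close> interior ones. In terms of the dual arrangement of
  \<open>m\<close> lines in the projective plane, no cell has more than five sides.

  The family is realised by the points \<open>(e, (-4)\<^sup>e)\<close> for \<open>e < m\<close>, which zigzag around the first
  axis with rapidly growing amplitude. The last of three points determines their orientation: a
  triple \<open>i < j < k\<close> is oriented according to the parity of \<open>k\<close> (\<open>det3_sign\<close>). By Cramer's rule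
  the circuit on \<open>i < j < k < l\<close> therefore has the signs \<open>+, -, +, -(-1)\<^bsup>k+l\<^esup>\<close>
  (\<open>zigzag_circuit\<close>).

  Let such a matroid be reoriented on \<open>A\<close>, with an acyclic result, and cut the ground set into
  maximal runs, the intervals contained in \<open>A\<close> or disjoint from it. Three facts make nearly
  everything interior. An element that comes after one representative of each of the first three
  runs is the fourth element of a circuit whose other three signs agree, so by acyclicity it carries
  the opposite sign (\<open>interior_after_two_changes\<close>). Within a run, every element apart from the
  first and the last two is interior (\<open>interior_of_run\<close>). Finally, if the second run has at least
  two elements, then every element of the first run except its last one is interior
  (\<open>interior_before_change\<close>). If the second run is long, only the last element of the first run,
  the first and the last two elements of the second run and the first element of the third run
  remain; if it is a single element or missing, only the first and the last two elements of the first
  run, that single element and the first element of the third run can remain. In both cases these are at most five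
  (\<open>few_extreme_elements\<close>).\<close>

section \<open>The oriented matroid of a linear subspace\<close>

definition supp :: "('a \<Rightarrow> real) \<Rightarrow> 'a set" where
  "supp x = {e. x e \<noteq> 0}"

definition sign_vector :: "('a \<Rightarrow> real) \<Rightarrow> 'a signed_set" where
  "sign_vector x = ({e. x e > 0}, {e. x e < 0})"

text \<open>The elementary vectors of a subspace are its nonzero vectors of minimal support; their sign
  vectors are the circuits of the oriented matroid that the subspace represents.\<close>

definition elementary :: "('a \<Rightarrow> real) set \<Rightarrow> ('a \<Rightarrow> real) \<Rightarrow> bool" where
  "elementary V x \<longleftrightarrow> x \<in> V \<and> supp x \<noteq> {} \<and>
    (\<forall>y\<in>V. supp y \<noteq> {} \<longrightarrow> supp y \<subseteq> supp x \<longrightarrow> supp y = supp x)"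

definition linear_circuits :: "('a \<Rightarrow> real) set \<Rightarrow> 'a signed_set set" where
  "linear_circuits V = sign_vector ` {x. elementary V x}"

lemma support_sign_vector [simp]: "support (sign_vector x) = supp x"
  by (auto simp: support_def sign_vector_def supp_def)

lemma sign_vector_scale_pos: "c > 0 \<Longrightarrow> sign_vector (\<lambda>e. c * x e) = sign_vector x"
  by (auto simp: sign_vector_def zero_less_mult_iff mult_less_0_iff)

lemma sign_vector_scale_neg: "c < 0 \<Longrightarrow> sign_vector (\<lambda>e. c * x e) = opposite (sign_vector x)"
  by (auto simp: sign_vector_def opposite_def zero_less_mult_iff mult_less_0_iff)

locale function_subspace =
  fixes E :: "'a set" and V :: "('a \<Rightarrow> real) set"
  assumes finite_E: "finite E"
    and supp_subset: "x \<in> V \<Longrightarrow> supp x \<subseteq> E"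
    and combination: "x \<in> V \<Longrightarrow> y \<in> V \<Longrightarrow> (\<lambda>e. a * x e + b * y e) \<in> V"
begin

lemma scale: "x \<in> V \<Longrightarrow> (\<lambda>e. c * x e) \<in> V"
  using combination[of x x c 0] by simp

lemma elementary_scale:
  assumes "elementary V x" "c \<noteq> 0"
  shows "elementary V (\<lambda>e. c * x e)"
proof -
  have "supp (\<lambda>e. c * x e) = supp x"
    using assms(2) by (simp add: supp_def)
  then show ?thesis
    using assms scale by (simp add: elementary_def)
qed

text \<open>A vector \<open>x\<close> that is not elementary can be moved along some \<open>y\<close> of strictly smaller support
  until a coordinate vanishes for the first time. No coordinate has changed its sign by then, and the
  support has shrunk, so the process can be iterated.\<close>

lemma conformal_elementary:
  assumes "x \<in> V" "supp x \<noteq> {}"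
  shows "\<exists>z. elementary V z \<and> {e. z e > 0} \<subseteq> {e. x e > 0} \<and> {e. z e < 0} \<subseteq> {e. x e < 0}"
  using assms
proof (induction "card (supp x)" arbitrary: x rule: less_induct)
  case less
  show ?case
  proof (cases "elementary V x")
    case True
    then show ?thesis by blast
  next
    case False
    then obtain y0 where y0: "y0 \<in> V" "supp y0 \<noteq> {}" "supp y0 \<subset> supp x"
      using less.prems unfolding elementary_def by blast
    have fin: "finite (supp x)"
      using supp_subset[OF less.prems(1)] finite_E finite_subset by blast
    obtain e0 where e0: "y0 e0 \<noteq> 0" "x e0 \<noteq> 0"
      using y0 by (auto simp: supp_def)
    \<comment> \<open>The factor gives \<open>x\<close> and \<open>y\<close> the same sign at \<open>e0\<close>, so that moving \<open>x\<close> in direction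
      \<open>- y\<close> makes some coordinate vanish.\<close>
    define y where "y = (\<lambda>e. (x e0 * y0 e0) * y0 e)"
    have y: "y \<in> V" "supp y = supp y0"
      using scale[OF y0(1)] e0 by (auto simp: y_def supp_def)
    define P where "P = {e. x e * y e > 0}"
    have "x e0 * y e0 = (x e0 * y0 e0)\<^sup>2"
      by (simp add: y_def power2_eq_square)
    then have "e0 \<in> P"
      using e0 by (simp add: P_def)
    moreover have "P \<subseteq> supp x"
      by (auto simp: P_def supp_def)
    ultimately have P: "finite P" "P \<noteq> {}"
      using fin finite_subset by auto
    obtain e where e: "e \<in> P" "\<And>f. f \<in> P \<Longrightarrow> x e / y e \<le> x f / y f"
      using ex_min_if_finite[of "(\<lambda>e. x e / y e) ` P"] P
      by (metis (no_types, lifting) arg_min_if_finite(1) arg_min_least)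
    \<comment> \<open>\<open>r\<close> is the first time at which a coordinate of \<open>x - r y\<close> vanishes.\<close>
    define r where "r = x e / y e"
    have r: "r > 0"
      using e(1) by (auto simp: P_def r_def zero_less_mult_iff zero_less_divide_iff)
    define z where "z = (\<lambda>f. 1 * x f + (- r) * y f)"
    have zV: "z \<in> V"
      unfolding z_def by (rule combination[OF less.prems(1) y(1)])
    have nonneg: "z f \<ge> 0" if "x f > 0" for f
    proof (cases "y f > 0")
      case True
      then have "r \<le> x f / y f"
        using e(2)[of f] that by (simp add: P_def r_def)
      then show ?thesis
        using True by (simp add: z_def pos_le_divide_eq)
    next
      case False
      then have "r * y f \<le> 0"
        using r by (simp add: mult_nonneg_nonpos)
      then show ?thesis using that by (simp add: z_def)
    qed
    have nonpos: "z f \<le> 0" if "x f < 0" for f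
    proof (cases "y f < 0")
      case True
      then have "r \<le> x f / y f"
        using e(2)[of f] that by (simp add: P_def r_def mult_neg_neg)
      then show ?thesis
        using True by (simp add: z_def neg_le_divide_eq)
    next
      case False
      then have "r * y f \<ge> 0"
        using r by simp
      then show ?thesis using that by (simp add: z_def)
    qed
    have zero: "z f = 0" if "x f = 0" for f
    proof -
      have "y f = 0" using that y(2) y0(3) by (auto simp: supp_def)
      then show ?thesis using that by (simp add: z_def)
    qed
    have conf: "{f. z f > 0} \<subseteq> {f. x f > 0}" "{f. z f < 0} \<subseteq> {f. x f < 0}"
      using nonneg nonpos zero
      by (metis (mono_tags, lifting) Collect_mono linorder_cases linorder_not_le order.irrefl)+
    have "z e = 0" "x e \<noteq> 0"
      using e(1) by (auto simp: z_def r_def P_def)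
    then have "supp z \<subset> supp x"
      using zero by (auto simp: supp_def)
    then have lt: "card (supp z) < card (supp x)"
      using fin by (rule psubset_card_mono[rotated])
    obtain f where "x f \<noteq> 0" "y f = 0"
      using y0(3) y(2) by (auto simp: supp_def)
    then have "z f \<noteq> 0"
      by (simp add: z_def)
    then have "supp z \<noteq> {}"
      by (auto simp: supp_def)
    from less.hyps[OF lt zV this] conf show ?thesis
      by blast
  qed
qed

text \<open>The combination of \<open>x\<close> and \<open>y\<close> that cancels a common coordinate has smaller support than
  \<open>y\<close>, so it is zero by the minimality of \<open>y\<close>.\<close>

lemma elementary_proportional:
  assumes y: "elementary V y" and x: "elementary V x" and sub: "supp x \<subseteq> supp y"
  obtains c where "c \<noteq> 0" "x = (\<lambda>f. c * y f)"
proof -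
  obtain e where e: "x e \<noteq> 0" "y e \<noteq> 0"
    using x sub by (auto simp: elementary_def supp_def)
  define z where "z = (\<lambda>f. y e * x f + (- x e) * y f)"
  have zV: "z \<in> V"
    unfolding z_def using x y by (intro combination) (auto simp: elementary_def)
  have "supp z \<subseteq> supp y"
    using sub by (auto simp: z_def supp_def)
  moreover have "e \<in> supp y - supp z"
    using e by (simp add: z_def supp_def)
  ultimately have "supp z = {}"
    using y zV unfolding elementary_def by (metis Diff_iff)
  then have "z f = 0" for f
    by (auto simp: supp_def)
  then have "x f = (x e / y e) * y f" for f
    using e by (simp add: z_def field_simps)
  then have "x = (\<lambda>f. (x e / y e) * y f)"
    by (rule ext)
  moreover have "x e / y e \<noteq> 0"
    using e by simp
  ultimately show thesis
    by (rule that[rotated])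
qed

text \<open>For the elimination axiom, the positive combination of \<open>x\<close> and \<open>y\<close> that cancels \<open>e\<close> takes its
  signs from \<open>x\<close> and \<open>y\<close>, and \<open>conformal_elementary\<close> provides a circuit conformal to it.\<close>

lemma linear_circuits_om: "oriented_matroid E (linear_circuits V)"
proof
  show "finite E" by (rule finite_E)
next
  fix X assume "X \<in> linear_circuits V"
  then show "support X \<subseteq> E"
    using supp_subset by (fastforce simp: linear_circuits_def elementary_def)
next
  fix X assume "X \<in> linear_circuits V"
  then show "fst X \<inter> snd X = {}"
    by (auto simp: linear_circuits_def sign_vector_def)
next
  show "({}, {}) \<notin> linear_circuits V"
  proof
    assume "({}, {}) \<in> linear_circuits V"
    then obtain x where x: "elementary V x" "sign_vector x = ({}, {})"
      by (auto simp: linear_circuits_def)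
    then have "support (sign_vector x) = {}"
      by (simp add: support_def)
    then show False
      using x(1) by (simp add: elementary_def)
  qed
next
  fix X assume "X \<in> linear_circuits V"
  then obtain x where x: "elementary V x" "X = sign_vector x"
    by (auto simp: linear_circuits_def)
  have "opposite X = sign_vector (\<lambda>e. (-1) * x e)"
    unfolding x(2) by (rule sign_vector_scale_neg[symmetric]) simp
  then show "opposite X \<in> linear_circuits V"
    using elementary_scale[OF x(1), of "-1"] by (auto simp: linear_circuits_def)
next
  fix X Y
  assume "X \<in> linear_circuits V" "Y \<in> linear_circuits V" and sub: "support X \<subseteq> support Y"
  then obtain x y where x: "elementary V x" "X = sign_vector x"
    and y: "elementary V y" "Y = sign_vector y"
    by (auto simp: linear_circuits_def)
  then obtain c where c: "c \<noteq> 0" "x = (\<lambda>f. c * y f)"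
    using elementary_proportional[OF y(1) x(1)] sub by auto
  then show "X = Y \<or> X = opposite Y"
    using sign_vector_scale_pos[of c y] sign_vector_scale_neg[of c y] x y
    by (metis linorder_neqE_linordered_idom)
next
  fix X Y e
  assume "X \<in> linear_circuits V" "Y \<in> linear_circuits V"
    and ne: "X \<noteq> opposite Y" and e: "e \<in> fst X \<inter> snd Y"
  then obtain x y where x: "elementary V x" "X = sign_vector x"
    and y: "elementary V y" "Y = sign_vector y"
    by (auto simp: linear_circuits_def)
  have pos: "x e > 0" "y e < 0"
    using e x y by (auto simp: sign_vector_def)
  define z where "z = (\<lambda>f. (- y e) * x f + x e * y f)"
  have zV: "z \<in> V"
    unfolding z_def using x y by (intro combination) (auto simp: elementary_def)
  have "supp z \<noteq> {}"
  proof
    assume "supp z = {}"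
    then have "z f = 0" for f
      by (auto simp: supp_def)
    then have "x = (\<lambda>f. (x e / y e) * y f)"
      using pos by (auto simp: z_def field_simps fun_eq_iff)
    then have "X = opposite Y"
      using sign_vector_scale_neg[of "x e / y e" y] pos x y by (simp add: divide_pos_neg)
    then show False using ne by simp
  qed
  then obtain w where w: "elementary V w"
      "{f. w f > 0} \<subseteq> {f. z f > 0}" "{f. w f < 0} \<subseteq> {f. z f < 0}"
    using conformal_elementary[OF zV] by blast
  have "x f > 0 \<or> y f > 0" if "z f > 0" for f
  proof (rule ccontr)
    assume "\<not> (x f > 0 \<or> y f > 0)"
    then have "(- y e) * x f \<le> 0" "x e * y f \<le> 0"
      using pos by (auto intro: mult_nonneg_nonpos simp del: mult_minus_left)
    then show False using that by (simp add: z_def)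
  qed
  moreover have "x f < 0 \<or> y f < 0" if "z f < 0" for f
  proof (rule ccontr)
    assume "\<not> (x f < 0 \<or> y f < 0)"
    then have "(- y e) * x f \<ge> 0" "x e * y f \<ge> 0"
      using pos by (auto intro: mult_nonneg_nonneg simp del: mult_minus_left)
    then show False using that by (simp add: z_def)
  qed
  moreover have "z e = 0"
    by (simp add: z_def)
  ultimately have
    "fst (sign_vector w) \<subseteq> (fst X \<union> fst Y) - {e}" "snd (sign_vector w) \<subseteq> (snd X \<union> snd Y) - {e}"
    using w(2,3) x(2) y(2) by (auto simp: sign_vector_def subset_iff)
  moreover have "sign_vector w \<in> linear_circuits V"
    using w(1) by (simp add: linear_circuits_def)
  ultimately show "\<exists>Z\<in>linear_circuits V.
      fst Z \<subseteq> (fst X \<union> fst Y) - {e} \<and> snd Z \<subseteq> (snd X \<union> snd Y) - {e}"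
    by blast
qed

end

section \<open>The zigzag configuration\<close>

text \<open>The linear dependencies among the vectors \<open>(1, e, (-4)\<^sup>e)\<close>, that is, the affine
  dependencies among the points \<open>(e, (-4)\<^sup>e)\<close> of the plane.\<close>

definition zigzag :: "nat \<Rightarrow> (nat \<Rightarrow> real) set" where
  "zigzag n = {x. supp x \<subseteq> {..<n} \<and> (\<Sum>e<n. x e) = 0 \<and>
    (\<Sum>e<n. x e * real e) = 0 \<and> (\<Sum>e<n. x e * (-4) ^ e) = 0}"

interpretation zigzag: function_subspace "{..<n}" "zigzag n" for n
proof
  fix x y :: "nat \<Rightarrow> real" and a b
  assume x: "x \<in> zigzag n" and y: "y \<in> zigzag n"
  have lin: "(\<Sum>e<n. (a * x e + b * y e) * w e) = a * (\<Sum>e<n. x e * w e) + b * (\<Sum>e<n. y e * w e)"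
    for w :: "nat \<Rightarrow> real"
    by (simp add: sum.distrib sum_distrib_left algebra_simps)
  have "supp (\<lambda>e. a * x e + b * y e) \<subseteq> supp x \<union> supp y"
    by (auto simp: supp_def)
  then show "(\<lambda>e. a * x e + b * y e) \<in> zigzag n"
    using x y lin[of "\<lambda>_. 1"] lin[of real] lin[of "\<lambda>e. (-4) ^ e"]
    by (auto simp: zigzag_def)
qed (auto simp: zigzag_def)

text \<open>The determinant of the vectors \<open>(1, e, (-4)\<^sup>e)\<close> for \<open>e = i, j, k\<close>, expanded along the last
  coordinate.\<close>

definition det3 :: "nat \<Rightarrow> nat \<Rightarrow> nat \<Rightarrow> real" where
  "det3 i j k = (real j - real i) * (-4) ^ k - (real k - real i) * (-4) ^ j
     + (real k - real j) * (-4) ^ i"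

text \<open>The term with \<open>(-4)\<^sup>k\<close> dominates: with \<open>p = j - i\<close> and \<open>q = k - j\<close>, Bernoulli's inequality
  gives \<open>p 4\<^sup>k \<ge> p (1 + 3 q) 4\<^sup>j\<close>, while the two other terms together are at most
  \<open>(p + 2 q) 4\<^sup>j\<close> in absolute value.\<close>

lemma det3_sign:
  assumes "i < j" "j < k"
  shows "(-1) ^ k * det3 i j k > 0"
proof -
  have four: "(-4::real) ^ e = (-1) ^ e * 4 ^ e" for e :: nat
    by (simp flip: power_mult_distrib)
  have bern: "(4::real) ^ d \<ge> 1 + 3 * real d" for d :: nat
    using Bernoulli_inequality[of "3::real" d] by (simp add: mult.commute)
  obtain p where p: "j = i + p" "p \<ge> 1" 
    using assms(1) by (metis less_imp_add_positive Suc_leI One_nat_def)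
  obtain q where q: "k = j + q" "q \<ge> 1" 
    using assms(2) by (metis less_imp_add_positive Suc_leI One_nat_def)
  let ?I = "(4::real) ^ i" and ?J = "(4::real) ^ j" and ?K = "(4::real) ^ k"
  have pos: "?I > 0" "?J > 0" by auto
  have IJ: "?I \<le> ?J" using assms by (intro power_increasing) auto
  have "?K = ?J * 4 ^ q" by (simp add: q power_add)
  then have K: "?K \<ge> ?J * (1 + 3 * real q)"
    using bern[of q] pos by (simp add: mult_left_mono)
  have abs1: "\<bar>(-1) ^ k * (-1) ^ e\<bar> = (1::real)" for e :: nat
    by (simp add: abs_mult power_abs)
  have "(-1) ^ k * det3 i j k = real p * ?K - ((-1) ^ k * (-1) ^ j) * ((real p + real q) * ?J)
      + ((-1) ^ k * (-1) ^ i) * (real q * ?I)"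
  proof -
    have diffs: "real j - real i = real p" "real k - real i = real p + real q"
      "real k - real j = real q"
      by (simp_all add: p(1) q(1))
    have distribute: "s * (a * (s * A) - b * (u * B) + c * (v * C)) =
        (s * s) * (a * A) - (s * u) * (b * B) + (s * v) * (c * C)" for s u v a b c A B C :: real
      by (simp add: algebra_simps)
    have "(-1) ^ k * (-1) ^ k = (1::real)"
      by (simp flip: power_add)
    then show ?thesis
      unfolding det3_def four diffs distribute by simp
  qed
  also have "\<dots> \<ge> real p * ?K - (real p + real q) * ?J - real q * ?I"
  proof -
    have "\<bar>((-1) ^ k * (-1) ^ j) * ((real p + real q) * ?J)\<bar> = (real p + real q) * ?J"
      "\<bar>((-1) ^ k * (-1) ^ i) * (real q * ?I)\<bar> = real q * ?I"
      by (simp_all only: abs_mult[of "(-1) ^ k * (-1) ^ _"] abs1) (simp_all add: abs_mult)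
    then show ?thesis by linarith
  qed
  finally have low: "(-1) ^ k * det3 i j k \<ge> real p * ?K - (real p + real q) * ?J - real q * ?I" .
  have "real p * ?K \<ge> real p * (?J * (1 + 3 * real q))"
    using K by (intro mult_left_mono) auto
  also have "real p * (?J * (1 + 3 * real q)) = real p * ?J + 3 * (real p * (real q * ?J))"
    by (simp add: algebra_simps)
  finally have 1: "real p * ?K \<ge> real p * ?J + 3 * (real p * (real q * ?J))" .
  have 2: "real p * (real q * ?J) \<ge> 1 * (real q * ?J)"
    using p by (intro mult_right_mono) auto
  have 3: "real q * ?I \<le> real q * ?J"
    using IJ by (intro mult_left_mono) auto
  have 4: "real q * ?J > 0" using q pos by simp
  have 5: "(real p + real q) * ?J = real p * ?J + real q * ?J"
    by (simp add: algebra_simps)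
  show ?thesis using low 1 2 3 4 5 by linarith
qed

text \<open>Any three of the vectors \<open>(1, e, (-4)\<^sup>e)\<close> are linearly independent, since their determinant
  does not vanish.\<close>

lemma zigzag_triple:
  assumes "x \<in> zigzag n" "supp x \<subseteq> {i, j, k}" "i < j" "j < k" "k < n"
  shows "supp x = {}"
proof -
  have s: "(\<Sum>e<n. x e * w e) = x i * w i + x j * w j + x k * w k" for w :: "nat \<Rightarrow> real"
  proof -
    have "(\<Sum>e<n. x e * w e) = (\<Sum>e\<in>{i, j, k}. x e * w e)"
      using assms by (intro sum.mono_neutral_right) (auto simp: supp_def)
    then show ?thesis using assms(3,4) by simp
  qed
  have eqs: "x i + x j + x k = 0" "x i * real i + x j * real j + x k * real k = 0"
    "x i * (-4) ^ i + x j * (-4) ^ j + x k * (-4) ^ k = 0"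
    using assms(1) s[of "\<lambda>_. 1"] s[of real] s[of "\<lambda>e. (-4) ^ e"] by (auto simp: zigzag_def)
  define a b c where "a = (-4::real) ^ i" and "b = (-4::real) ^ j" and "c = (-4::real) ^ k"
  have xi: "x i = - x j - x k" using eqs(1) by linarith
  have eq2: "x j * (real j - real i) = - x k * (real k - real i)"
    using eqs(2) unfolding xi by (simp add: algebra_simps)
  have eq3: "x j * (b - a) + x k * (c - a) = 0"
    using eqs(3) unfolding xi a_def b_def c_def by (simp add: algebra_simps)
  have "x k * det3 i j k = (real j - real i) * (x j * (b - a) + x k * (c - a))
      - (x j * (real j - real i) + x k * (real k - real i)) * (b - a)"
    by (simp add: det3_def a_def b_def c_def algebra_simps)
  then have "x k * det3 i j k = 0" using eq2 eq3 by simp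
  then have xk: "x k = 0" using det3_sign[OF assms(3,4)] by auto
  then have "x j = 0" using eq2 assms(3) by simp
  then show ?thesis using xi xk assms(2) by (auto simp: supp_def)
qed

text \<open>The signs of the dependency among four of the vectors, normalised so that the first is
  positive.\<close>

definition quad_signs :: "nat \<Rightarrow> nat \<Rightarrow> nat \<Rightarrow> nat \<Rightarrow> nat \<Rightarrow> real" where
  "quad_signs i j k l = (\<lambda>_. 0)(i := 1, j := - 1, k := 1, l := - ((-1) ^ (k + l)))"

text \<open>By Cramer's rule the coefficients of the dependency are the alternating \<open>3 \<times> 3\<close> minors. Three
  of these minors involve \<open>l\<close> and have the sign \<open>(-1)\<^sup>l\<close>, whereas the one that omits \<open>l\<close> has the
  sign \<open>(-1)\<^sup>k\<close>.\<close>

lemma zigzag_circuit: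
  assumes "i < j" "j < k" "k < l" "l < n"
  obtains x where "elementary (zigzag n) x" "sign_vector x = sign_vector (quad_signs i j k l)"
proof -
  define d :: "nat \<Rightarrow> real" where
    "d = (\<lambda>_. 0)(i := det3 j k l, j := - det3 i k l, k := det3 i j l, l := - det3 i j k)"
  define x where "x = (\<lambda>e. (-1) ^ l * d e)"
  have sign: "(-1) ^ l * det3 j k l > 0" "(-1) ^ l * det3 i k l > 0" "(-1) ^ l * det3 i j l > 0"
    "(-1) ^ k * det3 i j k > 0"
    using assms by (auto intro!: det3_sign)
  have ne: "det3 j k l \<noteq> 0" "det3 i k l \<noteq> 0" "det3 i j l \<noteq> 0" "det3 i j k \<noteq> 0"
    using sign by auto
  have supp_d: "supp d = {i, j, k, l}"
    using assms ne by (auto simp: d_def supp_def)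
  have s: "(\<Sum>e<n. d e * w e) =
      det3 j k l * w i - det3 i k l * w j + det3 i j l * w k - det3 i j k * w l" for w :: "nat \<Rightarrow> real"
  proof -
    have "(\<Sum>e<n. d e * w e) = (\<Sum>e\<in>{i, j, k, l}. d e * w e)"
      using assms supp_d by (intro sum.mono_neutral_right) (auto simp: supp_def)
    then show ?thesis using assms by (simp add: d_def)
  qed
  have "d \<in> zigzag n"
    using s[of "\<lambda>_. 1"] s[of real] s[of "\<lambda>e. (-4) ^ e"] assms supp_d
    by (auto simp: zigzag_def) (auto simp: det3_def algebra_simps)
  have min: "supp y = supp d" if "y \<in> zigzag n" "supp y \<noteq> {}" "supp y \<subseteq> supp d" for y
  proof (rule ccontr)
    assume "supp y \<noteq> supp d"
    then have "supp y \<subseteq> {j, k, l} \<or> supp y \<subseteq> {i, k, l} \<or> supp y \<subseteq> {i, j, l} \<or> supp y \<subseteq> {i, j, k}"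
      using that(3) unfolding supp_d by blast
    then show False
      using zigzag_triple[OF that(1), of j k l] zigzag_triple[OF that(1), of i k l]
        zigzag_triple[OF that(1), of i j l] zigzag_triple[OF that(1), of i j k] that(2) assms
      by auto
  qed
  have "elementary (zigzag n) d"
    using \<open>d \<in> zigzag n\<close> min supp_d by (auto simp: elementary_def)
  then have "elementary (zigzag n) x"
    unfolding x_def by (rule zigzag.elementary_scale) simp
  moreover have "sign_vector x = sign_vector (quad_signs i j k l)"
  proof -
    have "(-1) ^ l * det3 i j k = (-1) ^ (k + l) * ((-1) ^ k * det3 i j k)"
      by (simp add: power_add)
    then have last: "x l = quad_signs i j k l l * ((-1) ^ k * det3 i j k)"
      using assms by (simp add: x_def d_def quad_signs_def)
    have "\<exists>r>0. x e = r * quad_signs i j k l e" for e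
    proof -
      consider "e = i" | "e = j" | "e = k" | "e = l" | "e \<notin> {i, j, k, l}" by blast
      then show ?thesis
      proof cases
        case 1 then show ?thesis using assms sign(1)
          by (intro exI[of _ "(-1) ^ l * det3 j k l"]) (simp add: x_def d_def quad_signs_def)
      next
        case 2 then show ?thesis using assms sign(2)
          by (intro exI[of _ "(-1) ^ l * det3 i k l"]) (simp add: x_def d_def quad_signs_def)
      next
        case 3 then show ?thesis using assms sign(3)
          by (intro exI[of _ "(-1) ^ l * det3 i j l"]) (simp add: x_def d_def quad_signs_def)
      next
        case 4 then show ?thesis using last sign(4)
          by (intro exI[of _ "(-1) ^ k * det3 i j k"]) simp
      next
        case 5 then show ?thesis
          by (intro exI[of _ 1]) (simp add: x_def d_def quad_signs_def)
      qed
    qed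
    then have "(x e > 0) = (quad_signs i j k l e > 0) \<and> (x e < 0) = (quad_signs i j k l e < 0)" for e
      by (metis mult_pos_neg zero_less_mult_pos zero_less_mult_pos2 mult_pos_pos
          linorder_less_linear mult_zero_right order.asym)
    then show ?thesis by (simp add: sign_vector_def)
  qed
  ultimately show thesis using that by blast
qed

lemma Min_split:
  fixes S :: "nat set"
  assumes "finite S" "card S \<ge> Suc k"
  obtains i T where "S = insert i T" "\<forall>j\<in>T. i < j" "finite T" "card T \<ge> k" "card S = Suc (card T)"
proof -
  have ne: "S \<noteq> {}" using assms by auto
  have "\<forall>j\<in>S - {Min S}. Min S < j"
    using assms(1) by (auto simp: order.strict_iff_order)
  moreover have "S = insert (Min S) (S - {Min S})"
    using Min_in[OF assms(1) ne] by blast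
  moreover have "card S = Suc (card (S - {Min S}))"
    using Min_in[OF assms(1) ne] assms(1) by (rule card_Suc_Diff1[symmetric, rotated])
  ultimately show thesis
    using that[of "Min S" "S - {Min S}"] assms by simp
qed

lemma zigzag_independent:
  assumes "B \<subseteq> {..<n}" "card B = 3"
  shows "independent_in {..<n} (linear_circuits (zigzag n)) B"
proof -
  have fin: "finite B" using assms finite_subset by blast
  obtain i S where S: "B = insert i S" "\<forall>j\<in>S. i < j" "finite S" "card S = 2"
  proof (rule Min_split[OF fin, of 2])
    show "Suc 2 \<le> card B" using assms by simp
  qed (use assms in auto)
  obtain j T where T: "S = insert j T" "\<forall>k\<in>T. j < k" "finite T" "card T = 1"
  proof (rule Min_split[OF S(3), of 1])
    show "Suc 1 \<le> card S" using S by simp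
  qed (use S in auto)
  obtain k where k: "T = {k}" using T(4) card_1_singletonE by blast
  have "\<not> elementary (zigzag n) x" if "supp x \<subseteq> B" for x
    using zigzag_triple[of x n i j k] that assms S T k by (auto simp: elementary_def)
  then show ?thesis
    using assms(1) by (auto simp: independent_in_def linear_circuits_def)
qed

lemma zigzag_independent_card:
  assumes "independent_in {..<n} (linear_circuits (zigzag n)) I"
  shows "card I \<le> 3"
proof (rule ccontr)
  assume "\<not> card I \<le> 3"
  then have c: "card I \<ge> Suc 3" by simp
  have sub: "I \<subseteq> {..<n}" using assms by (simp add: independent_in_def)
  have fin: "finite I" using sub finite_subset by blast
  obtain i R where R: "I = insert i R" "\<forall>j\<in>R. i < j" "finite R" "card R \<ge> 3"
    by (rule Min_split[OF fin c])
  obtain j S where S: "R = insert j S" "\<forall>k\<in>S. j < k" "finite S" "card S \<ge> 2"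
  proof (rule Min_split[OF R(3), of 2])
    show "Suc 2 \<le> card R" using R by simp
  qed
  obtain k T where T: "S = insert k T" "\<forall>l\<in>T. k < l" "finite T" "card T \<ge> 1"
  proof (rule Min_split[OF S(3), of 1])
    show "Suc 1 \<le> card S" using S by simp
  qed
  obtain l where l: "l \<in> T" using T(4) by fastforce
  have ord: "i < j" "j < k" "k < l" "l < n" using R S T l sub by auto
  obtain x where x: "elementary (zigzag n) x"
      "sign_vector x = sign_vector (quad_signs i j k l)"
    by (rule zigzag_circuit[OF ord])
  have "supp x = supp (quad_signs i j k l)"
    using x(2) by (metis support_sign_vector)
  also have "\<dots> \<subseteq> {i, j, k, l}"
    by (auto simp: supp_def quad_signs_def)
  finally have "supp x \<subseteq> I" using R S T l by auto
  then show False
    using assms x(1) by (auto simp: independent_in_def linear_circuits_def)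
qed

lemma zigzag_rank:
  assumes "n \<ge> 3"
  shows "om_rank {..<n} (linear_circuits (zigzag n)) = 3"
proof -
  let ?R = "card ` {I. independent_in {..<n} (linear_circuits (zigzag n)) I}"
  have "card {..<3::nat} = 3" by simp
  then have "3 \<in> ?R"
    using zigzag_independent[of "{..<3}" n] assms by (metis (no_types) imageI lessThan_subset_iff mem_Collect_eq)
  moreover have "\<forall>r\<in>?R. r \<le> 3" using zigzag_independent_card by auto
  moreover have "finite ?R" using calculation(2) by (metis finite_nat_set_iff_bounded_le)
  ultimately show ?thesis unfolding om_rank_def by (intro Max_eqI) auto
qed

section \<open>Extreme elements of the reorientations\<close>

text \<open>Reorienting amounts to changing the signs of coordinates, so reoriented circuits are again sign
  vectors, of the functions called \<open>flipped\<close> below.\<close>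

definition reorient_sign :: "'a set \<Rightarrow> 'a \<Rightarrow> real" where
  "reorient_sign A e = (if e \<in> A then - 1 else 1)"

lemma flip_signs_sign_vector:
  "flip_signs A (sign_vector x) = sign_vector (\<lambda>e. reorient_sign A e * x e)"
  by (auto simp: flip_signs_def sign_vector_def reorient_sign_def)

context
  fixes n :: nat and A :: "nat set" and R :: "nat signed_set set"
  defines "R \<equiv> reorientation A (linear_circuits (zigzag n))"
begin

abbreviation flipped :: "nat \<Rightarrow> nat \<Rightarrow> nat \<Rightarrow> nat \<Rightarrow> nat \<Rightarrow> real" where
  "flipped i j k l e \<equiv> reorient_sign A e * quad_signs i j k l e"

lemma flipped_circuit:
  assumes "i < j" "j < k" "k < l" "l < n" "c \<noteq> 0"
  shows "sign_vector (\<lambda>e. c * flipped i j k l e) \<in> R"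
proof -
  obtain x where x: "elementary (zigzag n) x"
      "sign_vector x = sign_vector (quad_signs i j k l)"
    by (rule zigzag_circuit[OF assms(1-4)])
  have sv: "sign_vector (\<lambda>e. c * x e) = sign_vector (\<lambda>e. c * quad_signs i j k l e)"
    using x(2) assms(5) by (metis sign_vector_scale_neg sign_vector_scale_pos linorder_neqE_linordered_idom)
  have "sign_vector (\<lambda>e. c * x e) \<in> linear_circuits (zigzag n)"
    using zigzag.elementary_scale[OF x(1) assms(5)] by (auto simp: linear_circuits_def)
  then have "flip_signs A (sign_vector (\<lambda>e. c * quad_signs i j k l e)) \<in> R"
    unfolding R_def reorientation_def sv by blast
  then show ?thesis
    by (simp add: flip_signs_sign_vector mult.left_commute)
qed

lemma interior_if_lone_sign:
  assumes "i < j" "j < k" "k < l" "l < n" and d: "d \<in> {i, j, k, l}"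
    and lone: "\<And>e. e \<in> {i, j, k, l} - {d} \<Longrightarrow> flipped i j k l e = - flipped i j k l d"
  shows "d \<in> interior_elements {..<n} R"
proof -
  let ?y = "flipped i j k l"
  have nz: "?y e \<noteq> 0 \<longleftrightarrow> e \<in> {i, j, k, l}" for e
    by (auto simp: quad_signs_def reorient_sign_def)
  have yd: "?y d \<noteq> 0" using nz d by blast
  have pos: "?y d * ?y d > 0" using yd by (metis not_real_square_gt_zero)
  have "- ?y d * ?y e < 0 \<longleftrightarrow> e = d" for e
  proof (cases "e \<in> {i, j, k, l} - {d}")
    case True
    then show ?thesis using lone[OF True] pos by simp
  next
    case False
    then show ?thesis using nz[of e] pos by auto
  qed
  then have "snd (sign_vector (\<lambda>e. - ?y d * ?y e)) = {d}"
    by (auto simp: sign_vector_def)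
  moreover have "sign_vector (\<lambda>e. - ?y d * ?y e) \<in> R"
    using yd by (intro flipped_circuit assms(1-4)) simp
  moreover have "d < n" using assms(1-4) d by auto
  ultimately show ?thesis
    unfolding interior_elements_def by blast
qed

lemma acyclic_no_constant:
  assumes ac: "acyclic_om R" and o: "i < j" "j < k" "k < l" "l < n"
  shows "\<exists>e\<in>{j, k, l}. flipped i j k l e \<noteq> flipped i j k l i"
proof (rule ccontr)
  let ?y = "flipped i j k l"
  assume const: "\<not> ?thesis"
  have yi: "?y i \<noteq> 0" using o by (auto simp: quad_signs_def reorient_sign_def)
  have "?y i * ?y e \<ge> 0" for e
  proof (cases "e \<in> {i, j, k, l}")
    case True
    then have "?y e = ?y i" using const by blast
    then show ?thesis by simp
  next
    case False
    then show ?thesis by (auto simp: quad_signs_def)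
  qed
  then have "snd (sign_vector (\<lambda>e. ?y i * ?y e)) = {}"
    by (auto simp: sign_vector_def not_less)
  moreover have "sign_vector (\<lambda>e. ?y i * ?y e) \<in> R"
    using yi by (intro flipped_circuit o) simp
  ultimately show False using ac unfolding acyclic_om_def by blast
qed

text \<open>The signs at \<open>i\<close>, \<open>j\<close>, \<open>k\<close> alternate before the reorientation, and \<open>A\<close> separates \<open>j\<close> from
  both \<open>i\<close> and \<open>k\<close>, so they agree after it.\<close>

lemma interior_after_two_changes:
  assumes ac: "acyclic_om R" and o: "i < j" "j < k" "k < l" "l < n"
    and change: "(i \<in> A) \<noteq> (j \<in> A)" "(j \<in> A) \<noteq> (k \<in> A)"
  shows "l \<in> interior_elements {..<n} R"
proof (rule interior_if_lone_sign[OF o])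
  let ?y = "flipped i j k l"
  have eq: "?y j = ?y i" "?y k = ?y i"
    using o change by (auto simp: quad_signs_def reorient_sign_def)
  then have "?y l \<noteq> ?y i" using acyclic_no_constant[OF ac o] by auto
  moreover have "?y i = 1 \<or> ?y i = - 1" "?y l = 1 \<or> ?y l = - 1"
    using o by (cases "even (k + l)"; auto simp: quad_signs_def reorient_sign_def)+
  ultimately have "?y i = - ?y l" by argo
  then show "?y e = - ?y l" if "e \<in> {i, j, k, l} - {l}" for e
    using that eq by auto
qed simp

text \<open>On consecutive elements \<open>k\<close> and \<open>k + 1\<close> a circuit of the zigzag matroid takes equal signs, so
  its signs are \<open>+, -, +, +\<close>, and they keep this pattern, up to a global sign, within a run.\<close>

lemma interior_of_run:
  assumes o: "i < j" "j < k" "Suc k < n"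
    and run: "j \<in> A \<longleftrightarrow> i \<in> A" "k \<in> A \<longleftrightarrow> i \<in> A" "Suc k \<in> A \<longleftrightarrow> i \<in> A"
  shows "j \<in> interior_elements {..<n} R"
  by (rule interior_if_lone_sign[of i j k "Suc k"])
    (use assms in \<open>auto simp: quad_signs_def reorient_sign_def\<close>)

text \<open>Changing the signs at the last two elements turns \<open>+, -, +, +\<close> into \<open>+, -, -, -\<close>.\<close>

lemma interior_before_change:
  assumes o: "i < j" "j < k" "Suc k < n"
    and change: "j \<in> A \<longleftrightarrow> i \<in> A" "k \<in> A \<longleftrightarrow> i \<notin> A" "Suc k \<in> A \<longleftrightarrow> i \<notin> A"
  shows "i \<in> interior_elements {..<n} R"
  by (rule interior_if_lone_sign[of i j k "Suc k"])
    (use assms in \<open>auto simp: quad_signs_def reorient_sign_def\<close>)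

text \<open>The end of the run that starts at \<open>a\<close>. The value \<open>n\<close> stands for a run that lasts to the end
  of the ground set.\<close>

lemma next_change:
  assumes "a \<le> n"
  shows "\<exists>b. a \<le> b \<and> b \<le> n \<and> (\<forall>e. a \<le> e \<longrightarrow> e < b \<longrightarrow> (e \<in> A \<longleftrightarrow> a \<in> A)) \<and>
    (b < n \<longrightarrow> (b \<in> A) \<noteq> (a \<in> A))"
proof -
  let ?P = "\<lambda>b. a \<le> b \<and> (b = n \<or> (b \<in> A) \<noteq> (a \<in> A))"
  define b where "b = (LEAST b. ?P b)"
  have n: "?P n" using assms by simp
  then have b: "?P b" unfolding b_def by (rule LeastI)
  have "b \<le> n" unfolding b_def using n by (rule Least_le)
  moreover have "(e \<in> A) = (a \<in> A)" if "a \<le> e" "e < b" for e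
  proof -
    have "\<not> ?P e" using that(2) unfolding b_def by (rule not_less_Least)
    then show ?thesis using that(1) by blast
  qed
  moreover have "b < n \<longrightarrow> (b \<in> A) \<noteq> (a \<in> A)" using b by force
  ultimately show ?thesis using b by blast
qed

lemma few_extreme_elements:
  assumes ac: "acyclic_om R" and "n > 0"
  obtains S where "finite S" "card S \<le> 5" "{..<n} \<subseteq> interior_elements {..<n} R \<union> S"
proof -
  let ?I = "interior_elements {..<n} R"
  obtain a where a: "a \<le> n" "\<And>e. e < a \<Longrightarrow> e \<in> A \<longleftrightarrow> 0 \<in> A"
      "a < n \<Longrightarrow> (a \<in> A) \<noteq> (0 \<in> A)"
    using next_change[of 0] by blast
  obtain b where b: "a \<le> b" "b \<le> n" "\<And>e. a \<le> e \<Longrightarrow> e < b \<Longrightarrow> e \<in> A \<longleftrightarrow> a \<in> A"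
      "b < n \<Longrightarrow> (b \<in> A) \<noteq> (a \<in> A)"
    using next_change[OF a(1)] by blast
  \<comment> \<open>The second run begins at \<open>a\<close> and the third one at \<open>b\<close>; if there is no such run, the bound is
    \<open>n\<close>.\<close>
  have "0 < a" using a(3) \<open>n > 0\<close> by (cases a) auto
  have ab: "a < b" if "a < n" using b(1,4) that by (cases "a = b") auto
  have late: "e \<in> ?I" if "b < e" "e < n" for e
    by (rule interior_after_two_changes[OF ac, of "a - 1" a b])
      (use that a(2)[of "a - 1"] a(3) b(1,4) ab \<open>0 < a\<close> in auto)
  have run: "e \<in> ?I" if "x < e" "e + 2 < y" "y \<le> n" "\<And>f. x \<le> f \<Longrightarrow> f < y \<Longrightarrow> f \<in> A \<longleftrightarrow> x \<in> A"
    for x y e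
    by (rule interior_of_run[of x e "y - 2"])
      (use that(1-3) that(4)[of e] that(4)[of "y - 2"] that(4)[of "Suc (y - 2)"] in auto)
  show thesis
  proof (cases "a + 2 \<le> b")
    case True
    have "e \<in> ?I" if "e + 1 < a" for e
      by (rule interior_before_change[of e "a - 1" "b - 2"])
        (use that True b(2) a(2)[of e] a(2)[of "a - 1"] a(3) b(3)[of "b - 2"] b(3)[of "Suc (b - 2)"]
          in auto)
    moreover have "e \<in> ?I" if "a < e" "e + 2 < b" for e
      using run[of a e b] that b by blast
    ultimately have "e \<in> ?I \<union> {a - 1, a, b - 2, b - 1, b}" if "e < n" for e
    proof -
      have "e + 1 < a \<or> e = a - 1 \<or> e = a \<or> (a < e \<and> e + 2 < b) \<or> e = b - 2 \<or> e = b - 1 \<or> e = b \<or> b < e"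
        using \<open>0 < a\<close> True by arith
      then show ?thesis
        using late[of e] that \<open>\<And>e. e + 1 < a \<Longrightarrow> e \<in> ?I\<close> \<open>\<And>e. a < e \<Longrightarrow> e + 2 < b \<Longrightarrow> e \<in> ?I\<close>
        by blast
    qed
    moreover have "card {a - 1, a, b - 2, b - 1, b} \<le> 5"
      by (intro order.trans[OF card_insert_le_m1] order.refl) auto
    ultimately show thesis using that[of "{a - 1, a, b - 2, b - 1, b}"] by blast
  next
    case False
    have "e \<in> ?I" if "0 < e" "e + 2 < a" for e
      using run[of 0 e a] that a by blast
    moreover have "e = 0 \<or> (0 < e \<and> e + 2 < a) \<or> e = a - 2 \<or> e = a - 1 \<or> e = a \<or> e = b \<or> b < e" for e
      using False b(1) by arith
    ultimately have "e \<in> ?I \<union> {0, a - 2, a - 1, a, b}" if "e < n" for e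
      using late[of e] that by blast
    moreover have "card {0, a - 2, a - 1, a, b} \<le> 5"
      by (intro order.trans[OF card_insert_le_m1] order.refl) auto
    ultimately show thesis using that[of "{0, a - 2, a - 1, a, b}"] by blast
  qed
qed

end

lemma not_reorientable:
  assumes "m \<ge> t + 6"
  shows "\<not> reorientable t 2 m"
proof
  let ?C = "linear_circuits (zigzag m)"
  assume "reorientable t 2 m"
  moreover have rk: "om_rank {..<m} ?C = 2 + 1"
    using zigzag_rank[of m] assms by simp
  moreover have "uniform_om {..<m} ?C"
    using zigzag_independent rk by (simp add: uniform_om_def)
  ultimately obtain A where A: "acyclic_om (reorientation A ?C)"
      "card (interior_elements {..<m} (reorientation A ?C)) \<le> t"
    using zigzag.linear_circuits_om unfolding reorientable_def by (metis card_lessThan)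
  let ?I = "interior_elements {..<m} (reorientation A ?C)"
  obtain S where S: "finite S" "card S \<le> 5" "{..<m} \<subseteq> ?I \<union> S"
    using few_extreme_elements[OF A(1)] assms by auto
  have fin: "finite ?I" by (auto simp: interior_elements_def)
  have "{..<m} - S \<subseteq> ?I" using S(3) by blast
  then have "card ({..<m} - S) \<le> t" using card_mono[OF fin] A(2) by (meson order.trans)
  moreover have "card {..<m} - card S \<le> card ({..<m} - S)"
    using S(1) by (rule diff_card_le_card_Diff)
  ultimately show False using S(2) assms by simp
qed

theorem theorem4:
  fixes t :: nat
  shows "n_bar t 2 < enat (t + 6)"
proof -
  have "m \<le> t + 5" if "reorientable t 2 m" for m
    by (rule ccontr) (use not_reorientable[of t m] that in simp)
  then have "n_bar t 2 \<le> enat (t + 5)"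
    unfolding n_bar_def by (intro Sup_least) auto
  also have "\<dots> < enat (t + 6)" by simp
  finally show ?thesis .
qed

end
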